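(* Let $W$ be a graphon whose degree function $k(x)=\int_0^1W(x,y)\,dy$ satisfies $0<c\le k(x)$ for all $x\in[0,1]$, for some constant $c$. Then the eigenvalues of the normalized Laplacian $\mathcal L^{norm}:L^2[0,1]\to L^2[0,1]$, $$\mathcal L^{norm}f(x)=\int_0^1\frac{W(x,y)}{\sqrt{k(x)k(y)}}f(y)\,dy-f(x),$$ are non-positive reals, and the largest eigenvalue is zero. If moreover $W$ is connected, then the eigenvalue zero has multiplicity one.
   Context: A graphon is a symmetric Lebesgue-measurable function $W:[0,1]^2\to[0,1]$. It is connected if $\int_{S\times([0,1]\setminus S)}W(x,y)\,dx\,dy>0$ for every Lebesgue-measurable $S\subset[0,1]$ with Lebesgue measure $\mu(S)\in(0,1)$. *)

theory Defs
  imports "HOL-Analysis.Analysis" "HOL-Library.FuncSet"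
begin

abbreviation unit_lebesgue :: "real measure" where
  "unit_lebesgue \<equiv> lebesgue_on {0..1}"

text \<open>Only the values of \<open>W\<close> on the unit square matter; measurability is with respect to the
  (complete) two-dimensional Lebesgue measure.\<close>

definition graphon :: "(real \<Rightarrow> real \<Rightarrow> real) \<Rightarrow> bool" where
  "graphon W \<longleftrightarrow>
     (\<lambda>(x, y). W x y) \<in> borel_measurable (lebesgue_on ({0..1} \<times> {0..1})) \<and>
     (\<forall>x\<in>{0..1}. \<forall>y\<in>{0..1}. W x y = W y x) \<and>
     (\<forall>x\<in>{0..1}. \<forall>y\<in>{0..1}. W x y \<in> {0..1})"

definition connected_graphon :: "(real \<Rightarrow> real \<Rightarrow> real) \<Rightarrow> bool" where
  "connected_graphon W \<longleftrightarrow>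
     (\<forall>S\<in>sets lebesgue. S \<subseteq> {0..1} \<and> 0 < measure lebesgue S \<and> measure lebesgue S < 1 \<longrightarrow>
        0 < set_lebesgue_integral lebesgue (S \<times> ({0..1} - S)) (\<lambda>(x, y). W x y))"

text \<open>Sections of a Lebesgue-measurable function are measurable only for almost every \<open>x\<close>.  Where
  the section fails to be integrable the Bochner integral is \<open>0\<close>, so a bound \<open>0 < c \<le> graphon_degree W x\<close>
  at every point also says that the degree integral exists at every point.\<close>

definition graphon_degree :: "(real \<Rightarrow> real \<Rightarrow> real) \<Rightarrow> real \<Rightarrow> real" where
  "graphon_degree W x = (\<integral>y. W x y \<partial>unit_lebesgue)"

text \<open>The complex space \<open>L\<^sup>2[0,1]\<close>, represented by functions; equality of its elements is equality
  almost everywhere on the unit interval.  Complex scalars are used so that the reality of the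
  eigenvalues is a genuine assertion.\<close>

definition L2 :: "(real \<Rightarrow> complex) set" where
  "L2 = {f \<in> borel_measurable unit_lebesgue. integrable unit_lebesgue (\<lambda>x. (norm (f x))\<^sup>2)}"

definition normalized_laplacian ::
    "(real \<Rightarrow> real \<Rightarrow> real) \<Rightarrow> (real \<Rightarrow> complex) \<Rightarrow> real \<Rightarrow> complex" where
  "normalized_laplacian W f x =
     (\<integral>y. complex_of_real (W x y / sqrt (graphon_degree W x * graphon_degree W y)) * f y \<partial>unit_lebesgue) - f x"

definition eigenspace :: "((real \<Rightarrow> complex) \<Rightarrow> real \<Rightarrow> complex) \<Rightarrow> complex \<Rightarrow> (real \<Rightarrow> complex) set" where
  "eigenspace T \<nu> = {f \<in> L2. AE x in unit_lebesgue. T f x = \<nu> * f x}"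

definition eigenvalue :: "((real \<Rightarrow> complex) \<Rightarrow> real \<Rightarrow> complex) \<Rightarrow> complex \<Rightarrow> bool" where
  "eigenvalue T \<nu> \<longleftrightarrow> (\<exists>f\<in>eigenspace T \<nu>. \<not> (AE x in unit_lebesgue. f x = 0))"

text \<open>The eigenspace has dimension \<open>n\<close> over the complex numbers: it has a basis of \<open>n\<close> elements,
  independence and spanning being understood up to equality almost everywhere.\<close>

definition has_multiplicity ::
    "((real \<Rightarrow> complex) \<Rightarrow> real \<Rightarrow> complex) \<Rightarrow> complex \<Rightarrow> nat \<Rightarrow> bool" where
  "has_multiplicity T \<nu> n \<longleftrightarrow>
     (\<exists>e :: nat \<Rightarrow> real \<Rightarrow> complex.
        (\<forall>i<n. e i \<in> eigenspace T \<nu>) \<and>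
        (\<forall>a :: nat \<Rightarrow> complex. (AE x in unit_lebesgue. (\<Sum>i<n. a i * e i x) = 0) \<longrightarrow> (\<forall>i<n. a i = 0)) \<and>
        (\<forall>f\<in>eigenspace T \<nu>. \<exists>a :: nat \<Rightarrow> complex. AE x in unit_lebesgue. f x = (\<Sum>i<n. a i * e i x)))"

end

theory Submission imports Defs begin

text \<open>Write \<open>g = f / \<surd>k\<close>.  Since \<open>W\<close> is symmetric, expanding the square gives
  \<open>\<integral>\<integral> W(x,y) \<bar>g(x) - g(y)\<bar>\<^sup>2 = 2 (\<integral> k \<bar>g\<bar>\<^sup>2 - \<integral>\<integral> W(x,y) g(y) cnj (g(x)))\<close>, and in terms of \<open>f\<close> the right-hand
  side is \<open>-2 \<langle>L f, f\<rangle>\<close>, where \<open>L\<close> is the normalized Laplacian (\<open>dirichlet_form\<close> and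
  \<open>energy_of_eigenfunction\<close>).  So if \<open>L f = \<nu> f\<close>, then \<open>-2 \<nu> \<parallel>f\<parallel>\<^sup>2\<close> equals the double integral on the
  left, the energy of \<open>g\<close>, which is a non-negative real: \<open>\<nu>\<close> is real and non-positive.  The function \<open>\<surd>k\<close>, for which \<open>g = 1\<close>, is an
  eigenfunction for the value zero.

  If \<open>L f = 0\<close>, the energy vanishes, so \<open>g(x) = g(y)\<close> at almost every pair with \<open>W(x,y) \<noteq> 0\<close>.  A sublevel set
  \<open>S\<close> of \<open>Re g\<close> or of \<open>Im g\<close> therefore carries no weight of \<open>W\<close> across \<open>S \<times> ([0,1] - S)\<close>, and connectedness
  forces \<open>S\<close> to be null or conull.  A real function all of whose rational sublevel sets are null or
  conull is constant almost everywhere, so \<open>f\<close> is a multiple of \<open>\<surd>k\<close>.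

  These computations are applications of Fubini's theorem, which needs \<open>W\<close> to be measurable for the
  product of the one-dimensional \<open>\<sigma>\<close>-algebras, whereas a graphon is only measurable for the larger,
  complete two-dimensional one.  The spectral argument is hence carried out for a
  product-measurable kernel on an arbitrary finite measure space (\<open>symmetric_kernel\<close>).  A graphon is
  replaced by such a kernel that agrees with it almost everywhere (\<open>graphon_has_representative\<close>); this
  changes the Laplacian of a function only on a null set, and null sets of the two-dimensional
  Lebesgue measure and of the product measure correspond (\<open>AE_lebesgue_square_iff\<close>).\<close>

section \<open>Planar Lebesgue measure as a product\<close>

text \<open>The preimage under a projection of a null set \<open>A\<close> is a strip over \<open>A\<close>, which is null.  Hence the
  projections remain measurable after both sides are completed.\<close>

lemma measurable_fst_lebesgue: "fst \<in> (lebesgue :: ('a::euclidean_space \<times> 'b::euclidean_space) measure) \<rightarrow>\<^sub>M lebesgue"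
proof (rule completion.measurable_completion2)
  show "fst \<in> (lebesgue :: ('a \<times> 'b) measure) \<rightarrow>\<^sub>M lborel"
    by (rule measurable_completion) (simp flip: lborel_prod)
  show "null_sets lborel \<subseteq> null_sets (distr (lebesgue :: ('a \<times> 'b) measure) lborel fst)"
  proof
    fix A :: "'a set" assume A: "A \<in> null_sets lborel"
    then have [measurable]: "A \<in> sets lborel" by auto
    have "A \<times> UNIV \<in> null_sets (lborel \<Otimes>\<^sub>M (lborel :: 'b measure))"
      using A by (auto simp: null_sets_def lborel.emeasure_pair_measure_Times)
    then have "emeasure (lebesgue :: ('a \<times> 'b) measure) (A \<times> UNIV) = 0"
      by (metis lborel_prod null_setsD1 null_sets_completionI)
    moreover have "fst -` A \<inter> space (lebesgue :: ('a \<times> 'b) measure) = A \<times> UNIV"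
      by auto
    moreover have "fst \<in> (lebesgue :: ('a \<times> 'b) measure) \<rightarrow>\<^sub>M lborel"
      by (rule measurable_completion) (simp flip: lborel_prod)
    ultimately show "A \<in> null_sets (distr (lebesgue :: ('a \<times> 'b) measure) lborel fst)"
      using A by (auto simp: null_sets_def emeasure_distr)
  qed
qed

lemma measurable_snd_lebesgue: "snd \<in> (lebesgue :: ('a::euclidean_space \<times> 'b::euclidean_space) measure) \<rightarrow>\<^sub>M lebesgue"
proof (rule completion.measurable_completion2)
  show "snd \<in> (lebesgue :: ('a \<times> 'b) measure) \<rightarrow>\<^sub>M lborel"
    by (rule measurable_completion) (simp flip: lborel_prod)
  show "null_sets lborel \<subseteq> null_sets (distr (lebesgue :: ('a \<times> 'b) measure) lborel snd)"
  proof
    fix A :: "'b set" assume A: "A \<in> null_sets lborel"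
    then have [measurable]: "A \<in> sets lborel" by auto
    have "UNIV \<times> A \<in> null_sets ((lborel :: 'a measure) \<Otimes>\<^sub>M lborel)"
      using A by (auto simp: null_sets_def lborel.emeasure_pair_measure_Times)
    then have "emeasure (lebesgue :: ('a \<times> 'b) measure) (UNIV \<times> A) = 0"
      by (metis lborel_prod null_setsD1 null_sets_completionI)
    moreover have "snd -` A \<inter> space (lebesgue :: ('a \<times> 'b) measure) = UNIV \<times> A"
      by auto
    moreover have "snd \<in> (lebesgue :: ('a \<times> 'b) measure) \<rightarrow>\<^sub>M lborel"
      by (rule measurable_completion) (simp flip: lborel_prod)
    ultimately show "A \<in> null_sets (distr (lebesgue :: ('a \<times> 'b) measure) lborel snd)"
      using A by (auto simp: null_sets_def emeasure_distr)
  qed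
qed

text \<open>A Lebesgue set differs from a Borel subset by part of a Borel null set, so \<open>A \<times> B\<close> is squeezed
  between two Borel rectangles of the same measure.\<close>

lemma
  fixes A :: "'a::euclidean_space set" and B :: "'b::euclidean_space set"
  assumes A: "A \<in> sets lebesgue" and B: "B \<in> sets lebesgue"
  shows sets_lebesgue_Times: "A \<times> B \<in> sets lebesgue"
    and emeasure_lebesgue_Times: "emeasure lebesgue (A \<times> B) = emeasure lebesgue A * emeasure lebesgue B"
proof -
  have pre: "A \<times> B = (fst -` A \<inter> space lebesgue) \<inter> (snd -` B \<inter> space lebesgue)" for A :: "'a set" and B :: "'b set" by auto
  show AB: "A \<times> B \<in> sets lebesgue"
    unfolding pre using A B by (intro sets.Int measurable_sets[OF measurable_fst_lebesgue] measurable_sets[OF measurable_snd_lebesgue])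
  define A' where "A' = main_part lborel A"
  define B' where "B' = main_part lborel B"
  have A': "A' \<in> sets lborel" "emeasure lebesgue A = emeasure lborel A'"
    using A main_part_sets[OF A] unfolding A'_def by (auto simp del: main_part_sets)
  have B': "B' \<in> sets lborel" "emeasure lebesgue B = emeasure lborel B'"
    using B main_part_sets[OF B] unfolding B'_def by (auto simp del: main_part_sets)
  have nA: "A = A' \<union> null_part lborel A"
    using A by (auto simp: A'_def)
  have nB: "B = B' \<union> null_part lborel B"
    using B by (auto simp: B'_def)
  obtain NA where NA: "NA \<in> null_sets lborel" "null_part lborel A \<subseteq> NA" using null_part[OF A] by auto
  obtain NB where NB: "NB \<in> null_sets lborel" "null_part lborel B \<subseteq> NB" using null_part[OF B] by auto
  have le: "A \<times> B \<subseteq> (A' \<union> NA) \<times> (B' \<union> NB)" "A' \<times> B' \<subseteq> A \<times> B" using nA nB NA NB by auto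
  have Times: "emeasure lebesgue (X \<times> Y) = emeasure lborel X * emeasure lborel Y" "X \<times> Y \<in> sets lebesgue"
    if X: "X \<in> sets lborel" and Y: "Y \<in> sets lborel" for X :: "'a set" and Y :: "'b set"
  proof -
    have "X \<times> Y \<in> sets (lborel \<Otimes>\<^sub>M lborel)" using X Y by (rule pair_measureI)
    then have s: "X \<times> Y \<in> sets lborel" unfolding lborel_prod .
    then have "emeasure lebesgue (X \<times> Y) = emeasure lborel (X \<times> Y)" by simp
    also have "\<dots> = emeasure (lborel \<Otimes>\<^sub>M lborel) (X \<times> Y)" by (simp add: lborel_prod)
    also have "\<dots> = emeasure lborel X * emeasure lborel Y"
      using X Y by (rule lborel.emeasure_pair_measure_Times)
    finally show "emeasure lebesgue (X \<times> Y) = emeasure lborel X * emeasure lborel Y" .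
    show "X \<times> Y \<in> sets lebesgue" using s by auto
  qed
  have "emeasure lborel (A' \<union> NA) = emeasure lborel A'" "emeasure lborel (B' \<union> NB) = emeasure lborel B'"
    using A' B' NA NB by (auto intro: emeasure_Un_null_set)
  then have "emeasure lebesgue (A \<times> B) \<le> emeasure lborel A' * emeasure lborel B'"
    using emeasure_mono[OF le(1) Times(2)] Times(1)[of "A' \<union> NA" "B' \<union> NB"] A'(1) B'(1)
      null_setsD2[OF NA(1)] null_setsD2[OF NB(1)] sets.Un[OF A'(1) null_setsD2[OF NA(1)]] sets.Un[OF B'(1) null_setsD2[OF NB(1)]]
    by (auto simp del: emeasure_completion)
  moreover have "emeasure lborel A' * emeasure lborel B' \<le> emeasure lebesgue (A \<times> B)"
    using emeasure_mono[OF le(2) AB] Times[of A' B'] A'(1) B'(1) by (auto simp del: emeasure_completion)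
  ultimately show "emeasure lebesgue (A \<times> B) = emeasure lebesgue A * emeasure lebesgue B"
    using A' B' by auto
qed

lemma finite_measure_unit_lebesgue: "finite_measure unit_lebesgue"
  by (rule finite_measure_lebesgue_on) simp

abbreviation lebesgue_square :: "(real \<times> real) measure" where
  "lebesgue_square \<equiv> lebesgue_on ({0..1} \<times> {0..1})"

lemma measurable_ident_lebesgue_square:
  "(\<lambda>p. p) \<in> lebesgue_square \<rightarrow>\<^sub>M unit_lebesgue \<Otimes>\<^sub>M unit_lebesgue"
proof -
  have "fst \<in> lebesgue_square \<rightarrow>\<^sub>M unit_lebesgue" "snd \<in> lebesgue_square \<rightarrow>\<^sub>M unit_lebesgue"
    by (auto intro!: measurable_restrict_space3 measurable_fst_lebesgue measurable_snd_lebesgue)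
  then have "(\<lambda>p. (fst p, snd p)) \<in> lebesgue_square \<rightarrow>\<^sub>M unit_lebesgue \<Otimes>\<^sub>M unit_lebesgue"
    by (rule measurable_Pair)
  then show ?thesis by simp
qed

text \<open>The product of the one-dimensional Lebesgue measures is the restriction of the two-dimensional one to
  a smaller \<open>\<sigma>\<close>-algebra; the push-forward along the identity expresses this restriction.\<close>

lemma distr_lebesgue_square:
  "distr lebesgue_square (unit_lebesgue \<Otimes>\<^sub>M unit_lebesgue) (\<lambda>p. p) = unit_lebesgue \<Otimes>\<^sub>M unit_lebesgue"
proof (rule sym, rule pair_measure_eqI)
  show "sigma_finite_measure unit_lebesgue" "sigma_finite_measure unit_lebesgue"
    using finite_measure_unit_lebesgue by (auto simp: finite_measure_def)
  show "sets (unit_lebesgue \<Otimes>\<^sub>M unit_lebesgue) = sets (distr lebesgue_square (unit_lebesgue \<Otimes>\<^sub>M unit_lebesgue) (\<lambda>p. p))"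
    by simp
  fix A B :: "real set" assume AB: "A \<in> sets unit_lebesgue" "B \<in> sets unit_lebesgue"
  then have I: "A \<in> sets lebesgue" "A \<subseteq> {0..1}" "B \<in> sets lebesgue" "B \<subseteq> {0..1}"
    by (auto simp: sets_restrict_space_iff)
  have sq: "{0..1} \<times> {0..1} \<in> sets (lebesgue :: (real \<times> real) measure)"
    by (rule sets_lebesgue_Times) auto
  have "(\<lambda>p. p) -` (A \<times> B) \<inter> space lebesgue_square = A \<times> B" using I by auto
  then have "emeasure (distr lebesgue_square (unit_lebesgue \<Otimes>\<^sub>M unit_lebesgue) (\<lambda>p. p)) (A \<times> B) = emeasure lebesgue_square (A \<times> B)"
    using AB by (simp add: emeasure_distr[OF measurable_ident_lebesgue_square])
  also have "\<dots> = emeasure lebesgue (A \<times> B)"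
    using I sq by (intro emeasure_restrict_space) auto
  also have "\<dots> = emeasure unit_lebesgue A * emeasure unit_lebesgue B"
    using I by (simp del: emeasure_completion add: emeasure_lebesgue_Times emeasure_restrict_space)
  finally show "emeasure unit_lebesgue A * emeasure unit_lebesgue B =
     emeasure (distr lebesgue_square (unit_lebesgue \<Otimes>\<^sub>M unit_lebesgue) (\<lambda>p. p)) (A \<times> B)" by simp
qed

lemma borel_measurable_unit_lebesgue_prod:
  assumes "g \<in> borel_measurable (borel :: (real \<times> real) measure)"
  shows "g \<in> borel_measurable (unit_lebesgue \<Otimes>\<^sub>M unit_lebesgue)"
proof -
  have [measurable]: "(\<lambda>x. x) \<in> unit_lebesgue \<rightarrow>\<^sub>M borel"
    by (simp add: measurable_completion measurable_restrict_space1)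
  have "(\<lambda>p. (fst p, snd p)) \<in> unit_lebesgue \<Otimes>\<^sub>M unit_lebesgue \<rightarrow>\<^sub>M borel \<Otimes>\<^sub>M borel"
    by measurable
  then show ?thesis using assms by (simp add: borel_prod measurable_compose)
qed

text \<open>The two \<open>\<sigma>\<close>-algebras have the same exceptional sets because each two-dimensional null set lies in a
  Borel null set, which is measurable for the product.\<close>

lemma AE_lebesgue_square_iff:
  "(AE p in lebesgue_square. P p) \<longleftrightarrow> (AE p in unit_lebesgue \<Otimes>\<^sub>M unit_lebesgue. P p)"
proof
  assume "AE p in unit_lebesgue \<Otimes>\<^sub>M unit_lebesgue. P p"
  then have "AE p in distr lebesgue_square (unit_lebesgue \<Otimes>\<^sub>M unit_lebesgue) (\<lambda>p. p). P p"
    unfolding distr_lebesgue_square .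
  from AE_distrD[OF measurable_ident_lebesgue_square this]
  show "AE p in lebesgue_square. P p" .
next
  assume "AE p in lebesgue_square. P p"
  moreover have sq: "{0..1} \<times> {0..1} \<in> sets (lebesgue :: (real \<times> real) measure)"
    by (rule sets_lebesgue_Times) auto
  ultimately have "AE p in lborel. p \<in> {0..1} \<times> {0..1} \<longrightarrow> P p"
    by (simp add: AE_restrict_space_iff AE_completion_iff)
  then obtain N where N: "N \<in> null_sets lborel" "{p. \<not> (p \<in> {0..1} \<times> {0..1} \<longrightarrow> P p)} \<subseteq> N"
    unfolding eventually_ae_filter by auto
  let ?S = "N \<inter> ({0..1} \<times> {0..1})"
  \<comment> \<open>Borel measurability on the plane is transferred to the product through the indicator function.\<close>
  have "indicator N \<in> borel_measurable (unit_lebesgue \<Otimes>\<^sub>M unit_lebesgue)" (is "?i \<in> _")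
    using N by (intro borel_measurable_unit_lebesgue_prod) (auto simp: null_sets_def)
  then have "{p \<in> space (unit_lebesgue \<Otimes>\<^sub>M unit_lebesgue). ?i p = (1::real)} \<in> sets (unit_lebesgue \<Otimes>\<^sub>M unit_lebesgue)"
    by measurable
  moreover have "{p \<in> space (unit_lebesgue \<Otimes>\<^sub>M unit_lebesgue). ?i p = (1::real)} = ?S"
    by (auto simp: space_pair_measure indicator_def)
  ultimately have S: "?S \<in> sets (unit_lebesgue \<Otimes>\<^sub>M unit_lebesgue)" by simp
  have "(\<lambda>p. p) -` ?S \<inter> space lebesgue_square = ?S" by auto
  then have "emeasure (unit_lebesgue \<Otimes>\<^sub>M unit_lebesgue) ?S = emeasure lebesgue_square ?S"
    using emeasure_distr[OF measurable_ident_lebesgue_square S] by (simp add: distr_lebesgue_square)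
  also have "\<dots> = emeasure lebesgue ?S"
    using sq by (intro emeasure_restrict_space) auto
  also have "\<dots> = 0"
  proof -
    have "?S \<in> null_sets lebesgue"
      using null_sets_completion_subset[of ?S N lborel] N null_sets_completionI by blast
    then show ?thesis by (rule null_setsD1)
  qed
  finally show "AE p in unit_lebesgue \<Otimes>\<^sub>M unit_lebesgue. P p"
    using S N by (intro AE_I[of _ _ ?S]) (auto simp: space_pair_measure)
qed

section \<open>The Dirichlet form of a symmetric kernel\<close>

text \<open>The bounds and the symmetry are required at every point; a kernel satisfying them almost everywhere can be
  modified on a null set to meet this.\<close>

locale symmetric_kernel = finite_measure M for M :: "'a measure" +
  fixes K :: "'a \<Rightarrow> 'a \<Rightarrow> real"
  assumes kernel_measurable [measurable]: "(\<lambda>(x, y). K x y) \<in> borel_measurable (M \<Otimes>\<^sub>M M)"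
    and kernel_nonneg: "0 \<le> K x y"
    and kernel_le_one: "K x y \<le> 1"
    and kernel_sym: "K x y = K y x"
begin

definition degree :: "'a \<Rightarrow> real" where
  "degree x = (\<integral>y. K x y \<partial>M)"

lemma degree_measurable [measurable]: "degree \<in> borel_measurable M"
  unfolding degree_def by measurable

lemma integrable_kernel: "x \<in> space M \<Longrightarrow> integrable M (K x)"
  by (rule integrable_const_bound[of _ 1]) (auto simp: kernel_nonneg kernel_le_one)

lemma degree_nonneg: "0 \<le> degree x"
  unfolding degree_def by (intro integral_nonneg_AE) (auto simp: kernel_nonneg)

lemma degree_le: "degree x \<le> measure M (space M)"
proof (cases "integrable M (K x)")
  case True
  then have "degree x \<le> (\<integral>y. 1 \<partial>M)"
    unfolding degree_def by (intro integral_mono) (auto simp: kernel_le_one)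
  then show ?thesis by simp
qed (simp add: degree_def not_integrable_integral_eq)

lemma self_pair_sigma_finite: "pair_sigma_finite M M" ..

lemma integrable_kernel_fst:
  fixes u :: "'a \<Rightarrow> 'b::{banach, second_countable_topology}"
  assumes u: "integrable M u"
  shows "integrable (M \<Otimes>\<^sub>M M) (\<lambda>(x, y). K x y *\<^sub>R u x)"
proof -
  interpret P: pair_sigma_finite M M by (rule self_pair_sigma_finite)
  have [measurable]: "u \<in> borel_measurable M" using u by auto
  have "integrable (M \<Otimes>\<^sub>M M) (\<lambda>(x, y). u x)"
    using u by (intro P.Fubini_integrable) (auto simp: integrable_mult_right)
  then show ?thesis
    by (rule Bochner_Integration.integrable_bound)
       (measurable, auto intro!: AE_I2 mult_left_le_one_le simp: kernel_nonneg kernel_le_one)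
qed

lemma integral_kernel_fst:
  fixes u :: "'a \<Rightarrow> 'b::{banach, second_countable_topology}"
  assumes u: "integrable M u"
  shows "(\<integral>(x, y). K x y *\<^sub>R u x \<partial>(M \<Otimes>\<^sub>M M)) = (\<integral>x. degree x *\<^sub>R u x \<partial>M)"
proof -
  interpret P: pair_sigma_finite M M by (rule self_pair_sigma_finite)
  have "(\<integral>(x, y). K x y *\<^sub>R u x \<partial>(M \<Otimes>\<^sub>M M)) = (\<integral>x. \<integral>y. K x y *\<^sub>R u x \<partial>M \<partial>M)"
    by (rule P.integral_fst[symmetric]) (rule integrable_kernel_fst[OF u])
  also have "\<dots> = (\<integral>x. degree x *\<^sub>R u x \<partial>M)"
    unfolding degree_def by (intro Bochner_Integration.integral_cong refl integral_scaleR_left) (simp add: integrable_kernel)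
  finally show ?thesis .
qed

text \<open>Expand \<open>\<bar>g(x) - g(y)\<bar>\<^sup>2\<close>.  Exchanging \<open>x\<close> and \<open>y\<close> identifies the two diagonal terms with each other, and
  likewise the two mixed terms.  In particular the double integral on the right is real.\<close>

lemma dirichlet_form:
  fixes g :: "'a \<Rightarrow> complex"
  assumes g [measurable]: "g \<in> borel_measurable M" and g2: "integrable M (\<lambda>x. (norm (g x))\<^sup>2)"
  shows "integrable (M \<Otimes>\<^sub>M M) (\<lambda>(x, y). K x y * (norm (g x - g y))\<^sup>2)"
    and "complex_of_real (\<integral>(x, y). K x y * (norm (g x - g y))\<^sup>2 \<partial>(M \<Otimes>\<^sub>M M)) =
      2 * (complex_of_real (\<integral>x. degree x * (norm (g x))\<^sup>2 \<partial>M) - (\<integral>x. (\<integral>y. K x y * g y \<partial>M) * cnj (g x) \<partial>M))"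
proof -
  interpret P: pair_sigma_finite M M by (rule self_pair_sigma_finite)
  define a where "a = (\<lambda>(x, y). complex_of_real (K x y * (norm (g x))\<^sup>2))"
  define b where "b = (\<lambda>(x, y). K x y * g y * cnj (g x))"
  define c where "c = (\<lambda>(x, y). complex_of_real (K x y * (norm (g x - g y))\<^sup>2))"
  have [measurable]: "(\<lambda>x. cnj (g x)) \<in> borel_measurable M"
    by (rule borel_measurable_continuous_on[OF _ g]) (intro continuous_intros)
  have [measurable]: "a \<in> borel_measurable (M \<Otimes>\<^sub>M M)" "b \<in> borel_measurable (M \<Otimes>\<^sub>M M)"
    unfolding a_def b_def by measurable
  have ia0: "integrable (M \<Otimes>\<^sub>M M) (\<lambda>(x, y). K x y * (norm (g x))\<^sup>2)"
    using integrable_kernel_fst[OF g2] by simp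
  from integrable_of_real[OF this, where 'a = complex] have ia: "integrable (M \<Otimes>\<^sub>M M) a"
    by (simp add: a_def case_prod_unfold)
  have ia': "integrable (M \<Otimes>\<^sub>M M) (\<lambda>(x,y). a (y,x))"
    by (rule P.integrable_product_swap[OF ia])
  \<comment> \<open>The mixed term is dominated by the sum of the diagonal ones, since \<open>s t \<le> s\<^sup>2 + t\<^sup>2\<close>.\<close>
  have ib: "integrable (M \<Otimes>\<^sub>M M) b"
  proof (rule Bochner_Integration.integrable_bound)
    show "integrable (M \<Otimes>\<^sub>M M) (\<lambda>p. a p + (\<lambda>(x,y). a (y,x)) p)"
      by (intro Bochner_Integration.integrable_add ia ia')
    have "norm (b (x, y)) \<le> norm (a (x, y) + a (y, x))" for x y
    proof -
      have "norm (g y) * norm (g x) \<le> (norm (g x))\<^sup>2 + (norm (g y))\<^sup>2"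
      proof -
        have "2 * (norm (g y) * norm (g x)) \<le> (norm (g x))\<^sup>2 + (norm (g y))\<^sup>2"
          using sum_squares_bound[of "norm (g x)" "norm (g y)"] by (simp add: algebra_simps)
        moreover have "0 \<le> norm (g y) * norm (g x)" by simp
        ultimately show ?thesis by linarith
      qed
      then have "K x y * (norm (g y) * norm (g x)) \<le> K x y * ((norm (g x))\<^sup>2 + (norm (g y))\<^sup>2)"
        by (intro mult_left_mono kernel_nonneg)
      moreover have "a (x, y) + a (y, x) = complex_of_real (K x y * ((norm (g x))\<^sup>2 + (norm (g y))\<^sup>2))"
        by (simp add: a_def kernel_sym[of y x] algebra_simps)
      moreover have "norm (b (x, y)) = K x y * (norm (g y) * norm (g x))"
        by (simp add: b_def norm_mult kernel_nonneg)
      ultimately show ?thesis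
        by (simp only: norm_of_real)
    qed
    then show "AE p in M \<Otimes>\<^sub>M M. norm (b p) \<le> norm (a p + (\<lambda>(x,y). a (y,x)) p)"
      by auto
  qed measurable
  have ib': "integrable (M \<Otimes>\<^sub>M M) (\<lambda>(x,y). b (y,x))"
    by (rule P.integrable_product_swap[OF ib])
  have c_eq: "c = (\<lambda>p. a p + (\<lambda>(x,y). a (y,x)) p - (b p + (\<lambda>(x,y). b (y,x)) p))"
  proof (rule ext)
    fix p :: "'a \<times> 'a"
    obtain x y where p: "p = (x, y)" by fastforce
    have "complex_of_real ((norm (g x - g y))\<^sup>2) = (g x - g y) * cnj (g x - g y)"
      by (rule complex_norm_square)
    also have "\<dots> = complex_of_real ((norm (g x))\<^sup>2) + complex_of_real ((norm (g y))\<^sup>2) - (g y * cnj (g x) + g x * cnj (g y))"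
      by (simp only: complex_norm_square) (simp add: algebra_simps)
    finally show "c p = a p + (\<lambda>(x,y). a (y,x)) p - (b p + (\<lambda>(x,y). b (y,x)) p)"
      by (simp add: p c_def a_def b_def kernel_sym[of y x]) (simp add: algebra_simps)
  qed
  have ic: "integrable (M \<Otimes>\<^sub>M M) c"
    unfolding c_eq by (intro Bochner_Integration.integrable_diff Bochner_Integration.integrable_add ia ia' ib ib')
  have "integrable (M \<Otimes>\<^sub>M M) (\<lambda>p. Re (c p))"
    using ic by (rule integrable_Re)
  then show "integrable (M \<Otimes>\<^sub>M M) (\<lambda>(x, y). K x y * (norm (g x - g y))\<^sup>2)"
    by (simp add: c_def case_prod_unfold)
  have "complex_of_real (\<integral>(x, y). K x y * (norm (g x - g y))\<^sup>2 \<partial>(M \<Otimes>\<^sub>M M)) = integral\<^sup>L (M \<Otimes>\<^sub>M M) c"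
    by (simp add: c_def case_prod_unfold flip: integral_complex_of_real)
  also have "\<dots> = integral\<^sup>L (M \<Otimes>\<^sub>M M) a + (\<integral>(x,y). a (y,x) \<partial>(M \<Otimes>\<^sub>M M))
      - (integral\<^sup>L (M \<Otimes>\<^sub>M M) b + (\<integral>(x,y). b (y,x) \<partial>(M \<Otimes>\<^sub>M M)))"
    unfolding c_eq by (simp only: Bochner_Integration.integral_diff Bochner_Integration.integral_add
        Bochner_Integration.integrable_add ia ia' ib ib')
  also have "(\<integral>(x,y). a (y,x) \<partial>(M \<Otimes>\<^sub>M M)) = integral\<^sup>L (M \<Otimes>\<^sub>M M) a"
    by (rule P.integral_product_swap) measurable
  also have "(\<integral>(x,y). b (y,x) \<partial>(M \<Otimes>\<^sub>M M)) = integral\<^sup>L (M \<Otimes>\<^sub>M M) b"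
    by (rule P.integral_product_swap) measurable
  also have "integral\<^sup>L (M \<Otimes>\<^sub>M M) a = complex_of_real (\<integral>x. degree x * (norm (g x))\<^sup>2 \<partial>M)"
    using integral_kernel_fst[OF g2] unfolding a_def case_prod_unfold integral_complex_of_real by simp
  also have "integral\<^sup>L (M \<Otimes>\<^sub>M M) b = (\<integral>x. \<integral>y. K x y * g y * cnj (g x) \<partial>M \<partial>M)"
    unfolding b_def using ib by (intro P.integral_fst[symmetric]) (simp add: b_def)
  also have "\<dots> = (\<integral>x. (\<integral>y. K x y * g y \<partial>M) * cnj (g x) \<partial>M)"
    by simp
  finally show "complex_of_real (\<integral>(x, y). K x y * (norm (g x - g y))\<^sup>2 \<partial>(M \<Otimes>\<^sub>M M)) =
      2 * (complex_of_real (\<integral>x. degree x * (norm (g x))\<^sup>2 \<partial>M) - (\<integral>x. (\<integral>y. K x y * g y \<partial>M) * cnj (g x) \<partial>M))"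
    by simp
qed


text \<open>The normalized Laplacian of the kernel is this operator minus the identity.\<close>

definition normalized_kernel_operator :: "('a \<Rightarrow> complex) \<Rightarrow> 'a \<Rightarrow> complex" where
  "normalized_kernel_operator f x =
     (\<integral>y. complex_of_real (K x y / sqrt (degree x * degree y)) * f y \<partial>M)"

lemma normalized_kernel_operator_measurable [measurable]:
  assumes [measurable]: "f \<in> borel_measurable M"
  shows "normalized_kernel_operator f \<in> borel_measurable M"
  unfolding normalized_kernel_operator_def by measurable

text \<open>As \<open>0 \<le> K \<le> 1\<close>, the normalized kernel is at most \<open>1 / c\<close>, and on a finite measure space square
  integrability implies integrability.\<close>

lemma normalized_kernel_operator_bounded:
  assumes [measurable]: "f \<in> borel_measurable M" and f: "integrable M (\<lambda>x. (norm (f x))\<^sup>2)"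
    and "0 < c" and deg: "AE x in M. c \<le> degree x"
  shows "AE x in M. norm (normalized_kernel_operator f x) \<le> (\<integral>y. norm (f y) / c \<partial>M)"
proof -
  have f1: "integrable M (\<lambda>y. norm (f y) / c)"
    using square_integrable_imp_integrable[of "\<lambda>y. norm (f y)"] f by simp
  from deg show ?thesis
  proof (rule AE_mp, intro AE_I2 impI)
    fix x assume x: "x \<in> space M" "c \<le> degree x"
    have "AE y in M. norm (complex_of_real (K x y / sqrt (degree x * degree y)) * f y) \<le> norm (f y) / c"
      using deg
    proof (rule AE_mp, intro AE_I2 impI)
      fix y assume y: "c \<le> degree y"
      have "c = sqrt (c * c)" using \<open>0 < c\<close> by simp
      also have "\<dots> \<le> sqrt (degree x * degree y)"
        using x y \<open>0 < c\<close> by (intro real_sqrt_le_mono mult_mono) auto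
      finally have s: "c \<le> sqrt (degree x * degree y)" .
      have "K x y / sqrt (degree x * degree y) \<le> 1 / c"
        using s \<open>0 < c\<close> by (intro frac_le) (auto simp: kernel_nonneg kernel_le_one)
      moreover have "0 \<le> K x y / sqrt (degree x * degree y)"
        using s \<open>0 < c\<close> by (intro divide_nonneg_nonneg kernel_nonneg) linarith
      ultimately have "norm (complex_of_real (K x y / sqrt (degree x * degree y))) \<le> 1 / c"
        by (simp only: norm_of_real abs_of_nonneg)
      then have "norm (complex_of_real (K x y / sqrt (degree x * degree y))) * norm (f y) \<le> 1 / c * norm (f y)"
        by (rule mult_right_mono) simp
      then show "norm (complex_of_real (K x y / sqrt (degree x * degree y)) * f y) \<le> norm (f y) / c"
        by (simp only: norm_mult) simp
    qed
    then have "(\<integral>y. norm (complex_of_real (K x y / sqrt (degree x * degree y)) * f y) \<partial>M) \<le> (\<integral>y. norm (f y) / c \<partial>M)"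
    proof (rule integral_mono_AE'[OF f1])
      show "AE y in M. 0 \<le> norm (f y) / c" using \<open>0 < c\<close> by simp
    qed
    then show "norm (normalized_kernel_operator f x) \<le> (\<integral>y. norm (f y) / c \<partial>M)"
      unfolding normalized_kernel_operator_def by (rule order_trans[OF integral_norm_bound])
  qed
qed

lemma normalized_kernel_operator_square_integrable:
  assumes [measurable]: "f \<in> borel_measurable M" and f: "integrable M (\<lambda>x. (norm (f x))\<^sup>2)"
    and "0 < c" and deg: "AE x in M. c \<le> degree x"
  shows "integrable M (\<lambda>x. (norm (normalized_kernel_operator f x))\<^sup>2)"
proof (rule integrable_const_bound)
  show "AE x in M. norm ((norm (normalized_kernel_operator f x))\<^sup>2) \<le> (\<integral>y. norm (f y) / c \<partial>M)\<^sup>2"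
    using normalized_kernel_operator_bounded[OF assms]
    by eventually_elim (auto intro!: power_mono)
qed measurable

definition dirichlet_energy :: "('a \<Rightarrow> complex) \<Rightarrow> real" where
  "dirichlet_energy g = (\<integral>(x, y). K x y * (norm (g x - g y))\<^sup>2 \<partial>(M \<Otimes>\<^sub>M M))"

lemma dirichlet_energy_nonneg: "0 \<le> dirichlet_energy g"
  unfolding dirichlet_energy_def by (intro integral_nonneg_AE) (auto simp: kernel_nonneg)

lemma square_integrable_rescaled:
  fixes f :: "'a \<Rightarrow> complex"
  assumes [measurable]: "f \<in> borel_measurable M" and f: "integrable M (\<lambda>x. (norm (f x))\<^sup>2)"
    and "0 < c" and deg: "AE x in M. c \<le> degree x"
  shows "integrable M (\<lambda>x. (norm (f x / sqrt (degree x)))\<^sup>2)"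
proof (rule Bochner_Integration.integrable_bound)
  show "integrable M (\<lambda>x. (norm (f x))\<^sup>2 / c)" using f by simp
  show "AE x in M. norm ((norm (f x / sqrt (degree x)))\<^sup>2) \<le> norm ((norm (f x))\<^sup>2 / c)"
    using deg by eventually_elim (use \<open>0 < c\<close> in \<open>auto simp: norm_divide power_divide intro!: frac_le\<close>)
qed measurable

text \<open>With \<open>g = f / \<surd>degree\<close> the two terms of the Dirichlet form become \<open>\<parallel>f\<parallel>\<^sup>2\<close> and the inner product of
  \<open>normalized_kernel_operator f\<close> with \<open>f\<close>, which is \<open>(1 + \<nu>) \<parallel>f\<parallel>\<^sup>2\<close> for an eigenfunction.\<close>

lemma energy_of_eigenfunction:
  assumes [measurable]: "f \<in> borel_measurable M" and f: "integrable M (\<lambda>x. (norm (f x))\<^sup>2)"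
    and "0 < c" and deg: "AE x in M. c \<le> degree x"
    and eig: "AE x in M. normalized_kernel_operator f x - f x = \<nu> * f x"
  shows "complex_of_real (dirichlet_energy (\<lambda>x. f x / sqrt (degree x))) =
           - 2 * \<nu> * complex_of_real (\<integral>x. (norm (f x))\<^sup>2 \<partial>M)"
proof -
  define g where "g = (\<lambda>x. f x / sqrt (degree x))"
  have [measurable]: "g \<in> borel_measurable M" unfolding g_def by measurable
  have cnj_meas [measurable]: "(\<lambda>x. cnj (f x)) \<in> borel_measurable M" "(\<lambda>x. cnj (g x)) \<in> borel_measurable M"
    by (rule borel_measurable_continuous_on[where f = cnj], intro continuous_intros, measurable)+
  have g2: "integrable M (\<lambda>x. (norm (g x))\<^sup>2)"
    unfolding g_def by (rule square_integrable_rescaled[OF assms(1-4)])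
  have "(\<integral>x. degree x * (norm (g x))\<^sup>2 \<partial>M) = (\<integral>x. (norm (f x))\<^sup>2 \<partial>M)"
  proof (rule integral_cong_AE)
    show "AE x in M. degree x * (norm (g x))\<^sup>2 = (norm (f x))\<^sup>2"
      using deg by eventually_elim (use \<open>0 < c\<close> in \<open>auto simp: g_def norm_divide power_divide\<close>)
  qed measurable
  moreover have "(\<integral>x. (\<integral>y. K x y * g y \<partial>M) * cnj (g x) \<partial>M) = (1 + \<nu>) * complex_of_real (\<integral>x. (norm (f x))\<^sup>2 \<partial>M)"
  proof -
    have N: "normalized_kernel_operator f x = (\<integral>y. K x y * g y \<partial>M) / sqrt (degree x)" for x
    proof -
      have "normalized_kernel_operator f x = (\<integral>y. (K x y * g y) / sqrt (degree x) \<partial>M)"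
        unfolding normalized_kernel_operator_def g_def
        by (intro Bochner_Integration.integral_cong refl) (simp add: real_sqrt_mult)
      then show ?thesis by simp
    qed
    have "(\<integral>x. (\<integral>y. K x y * g y \<partial>M) * cnj (g x) \<partial>M) = (\<integral>x. normalized_kernel_operator f x * cnj (f x) \<partial>M)"
      by (intro Bochner_Integration.integral_cong refl) (simp add: N g_def)
    also have "\<dots> = (\<integral>x. (1 + \<nu>) * complex_of_real ((norm (f x))\<^sup>2) \<partial>M)"
    proof (rule integral_cong_AE)
      show "AE x in M. normalized_kernel_operator f x * cnj (f x) = (1 + \<nu>) * complex_of_real ((norm (f x))\<^sup>2)"
        using eig
      proof eventually_elim
        case (elim x)
        then have "normalized_kernel_operator f x = (1 + \<nu>) * f x"
          by (simp add: algebra_simps)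
        then show ?case by (simp only: complex_norm_square mult.assoc)
      qed
    qed measurable
    also have "\<dots> = (1 + \<nu>) * complex_of_real (\<integral>x. (norm (f x))\<^sup>2 \<partial>M)"
      by (simp only: integral_mult_right_zero integral_complex_of_real)
    finally show ?thesis .
  qed
  moreover note dirichlet_form(2)[OF \<open>g \<in> borel_measurable M\<close> g2]
  ultimately show ?thesis
    unfolding dirichlet_energy_def g_def by (simp add: algebra_simps)
qed

text \<open>The energy and \<open>\<parallel>f\<parallel>\<^sup>2 > 0\<close> are real and determine \<open>\<nu>\<close> as \<open>- energy / (2 \<parallel>f\<parallel>\<^sup>2)\<close>.\<close>

lemma eigenvalue_nonpos:
  assumes f_meas [measurable]: "f \<in> borel_measurable M" and f: "integrable M (\<lambda>x. (norm (f x))\<^sup>2)"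
    and "0 < c" and deg: "AE x in M. c \<le> degree x"
    and eig: "AE x in M. normalized_kernel_operator f x - f x = \<nu> * f x"
    and nz: "\<not> (AE x in M. f x = 0)"
  shows "\<nu> \<in> \<real> \<and> Re \<nu> \<le> 0"
proof -
  define n where "n = (\<integral>x. (norm (f x))\<^sup>2 \<partial>M)"
  define e where "e = dirichlet_energy (\<lambda>x. f x / sqrt (degree x))"
  have "n \<noteq> 0"
    unfolding n_def using nz by (subst integral_nonneg_eq_0_iff_AE[OF f]) auto
  moreover have "0 \<le> n" unfolding n_def by simp
  ultimately have n: "0 < n" by simp
  have e: "0 \<le> e" unfolding e_def by (rule dirichlet_energy_nonneg)
  have "complex_of_real e = - 2 * \<nu> * complex_of_real n"
    unfolding n_def e_def using energy_of_eigenfunction[OF assms(1-5)] .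
  then have "\<nu> = complex_of_real (- e / (2 * n))"
    using n by (simp add: field_simps)
  then show ?thesis using n e by simp
qed

text \<open>The energy of a null eigenfunction vanishes, hence so does its non-negative integrand almost everywhere.\<close>

lemma null_eigenfunction_locally_constant:
  assumes [measurable]: "f \<in> borel_measurable M" and f: "integrable M (\<lambda>x. (norm (f x))\<^sup>2)"
    and "0 < c" and deg: "AE x in M. c \<le> degree x"
    and eig: "AE x in M. normalized_kernel_operator f x - f x = 0"
  shows "AE (x, y) in M \<Otimes>\<^sub>M M. K x y = 0 \<or> f x / sqrt (degree x) = f y / sqrt (degree y)"
proof -
  define g where "g = (\<lambda>x. f x / sqrt (degree x))"
  have g: "g \<in> borel_measurable M" unfolding g_def by measurable
  have g2: "integrable M (\<lambda>x. (norm (g x))\<^sup>2)"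
    unfolding g_def by (rule square_integrable_rescaled[OF assms(1-4)])
  have "dirichlet_energy g = 0"
    using energy_of_eigenfunction[OF assms(1-4), of 0] eig by (simp add: g_def)
  then have "AE p in M \<Otimes>\<^sub>M M. (\<lambda>(x, y). K x y * (norm (g x - g y))\<^sup>2) p = 0"
    unfolding dirichlet_energy_def
    by (subst (asm) integral_nonneg_eq_0_iff_AE[OF dirichlet_form(1)[OF g g2]]) (auto simp: kernel_nonneg)
  then show ?thesis
    by eventually_elim (auto simp: g_def)
qed

lemma sqrt_degree_null_eigenfunction:
  assumes "0 < c" and deg: "AE x in M. c \<le> degree x"
  shows "AE x in M. normalized_kernel_operator (\<lambda>y. complex_of_real (sqrt (degree y))) x = complex_of_real (sqrt (degree x))"
  using deg
proof (rule AE_mp, intro AE_I2 impI)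
  fix x assume x: "x \<in> space M" "c \<le> degree x"
  have "normalized_kernel_operator (\<lambda>y. complex_of_real (sqrt (degree y))) x = (\<integral>y. complex_of_real (K x y / sqrt (degree x)) \<partial>M)"
    unfolding normalized_kernel_operator_def
  proof (rule integral_cong_AE)
    show "AE y in M. complex_of_real (K x y / sqrt (degree x * degree y)) * complex_of_real (sqrt (degree y)) = complex_of_real (K x y / sqrt (degree x))"
      using deg by eventually_elim (use \<open>0 < c\<close> in \<open>auto simp: real_sqrt_mult\<close>)
  qed (use x in measurable)
  also have "\<dots> = complex_of_real (degree x / sqrt (degree x))"
    by (simp only: integral_complex_of_real integral_divide_zero degree_def)
  also have "\<dots> = complex_of_real (sqrt (degree x))"
    using x \<open>0 < c\<close> by (simp add: real_div_sqrt)
  finally show "normalized_kernel_operator (\<lambda>y. complex_of_real (sqrt (degree y))) x = complex_of_real (sqrt (degree x))" .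
qed

end

section \<open>Functions with trivial sublevel sets\<close>

text \<open>Almost every point lies on the prescribed side of every rational threshold at once, and the rational
  thresholds separate distinct reals; so \<open>h\<close> takes a single value at all these points.  The filter is
  non-trivial exactly when the space is not null.\<close>

lemma AE_constant_if_dichotomy:
  fixes h :: "'a \<Rightarrow> real"
  assumes nz: "ae_filter M \<noteq> bot"
    and dich: "\<And>q. q \<in> \<rat> \<Longrightarrow> (AE x in M. h x \<le> q) \<or> (AE x in M. q < h x)"
  shows "\<exists>t. AE x in M. h x = t"
proof -
  define Q where "Q q \<longleftrightarrow> (AE x in M. h x \<le> q)" for q
  have "AE x in M. \<forall>q\<in>\<rat>. h x \<le> q \<longleftrightarrow> Q q"
  proof (subst AE_ball_countable[OF countable_rat], intro ballI)
    fix q :: real assume "q \<in> \<rat>"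
    show "AE x in M. h x \<le> q \<longleftrightarrow> Q q"
    proof (cases "Q q")
      case False
      then have "AE x in M. q < h x" using dich[OF \<open>q \<in> \<rat>\<close>] by (simp add: Q_def)
      then show ?thesis by eventually_elim (use False in auto)
    qed (simp add: Q_def)
  qed
  note all = this
  then obtain x0 where x0: "\<forall>q\<in>\<rat>. h x0 \<le> q \<longleftrightarrow> Q q"
    using eventually_happens'[OF nz] by blast
  from all have "AE x in M. h x = h x0"
  proof eventually_elim
    case (elim x)
    show ?case
    proof (rule linorder_cases[of "h x" "h x0"])
      assume "h x < h x0"
      then obtain q where "q \<in> \<rat>" "h x < q" "q < h x0" using Rats_dense_in_real by blast
      then show ?thesis using elim x0 by force
    next
      assume "h x0 < h x"
      then obtain q where "q \<in> \<rat>" "h x0 < q" "q < h x" using Rats_dense_in_real by blast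
      then show ?thesis using elim x0 by force
    qed
  qed
  then show ?thesis by blast
qed

section \<open>Product-measurable representatives of graphons\<close>

text \<open>The sections, the degree and the Laplacian of a graphon are known to be measurable only through their
  almost everywhere agreement with those of its representative.\<close>

lemma (in complete_measure) borel_measurable_cong_AE:
  fixes f g :: "'a \<Rightarrow> 'b::topological_space"
  assumes f: "f \<in> borel_measurable M" and ae: "AE x in M. f x = g x"
  shows "g \<in> borel_measurable M"
proof (rule measurableI)
  fix A :: "'b set" assume "A \<in> sets borel"
  then have sets: "f -` A \<inter> space M \<in> sets M" by (rule measurable_sets[OF f])
  have "AE x in M. x \<in> f -` A \<inter> space M \<longleftrightarrow> x \<in> g -` A \<inter> space M"
    using ae by eventually_elim auto
  from in_sets_AE[OF this sets] show "g -` A \<inter> space M \<in> sets M" by simp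
qed simp

lemma complete_unit_lebesgue: "complete_measure unit_lebesgue"
proof
  fix A B :: "real set" assume B: "B \<subseteq> A" "A \<in> null_sets unit_lebesgue"
  then have "A \<in> null_sets lebesgue" "A \<subseteq> {0..1}" by (auto simp: null_sets_restrict_space)
  then have "B \<in> null_sets lebesgue" "B \<subseteq> {0..1}"
    using B null_sets_completion_subset by blast+
  then have "B \<in> null_sets unit_lebesgue" by (auto simp: null_sets_restrict_space)
  then show "B \<in> sets unit_lebesgue" by (rule null_setsD2)
qed

locale graphon_representative = symmetric_kernel unit_lebesgue K for K +
  fixes W :: "real \<Rightarrow> real \<Rightarrow> real"
  assumes representative: "AE (x, y) in unit_lebesgue \<Otimes>\<^sub>M unit_lebesgue. W x y = K x y"
begin

sublocale complete_measure unit_lebesgue by (rule complete_unit_lebesgue)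

lemma sections_agree: "AE x in unit_lebesgue. AE y in unit_lebesgue. W x y = K x y"
proof -
  interpret P: pair_sigma_finite unit_lebesgue unit_lebesgue by (rule self_pair_sigma_finite)
  show ?thesis using P.AE_pair[OF representative] by simp
qed

lemma graphon_degree_eq: "AE x in unit_lebesgue. graphon_degree W x = degree x"
  using sections_agree
proof (rule AE_mp, intro AE_I2 impI)
  fix x assume [measurable]: "x \<in> space unit_lebesgue" and ae: "AE y in unit_lebesgue. W x y = K x y"
  have K: "K x \<in> borel_measurable unit_lebesgue" by measurable
  have "AE y in unit_lebesgue. K x y = W x y" using ae by eventually_elim simp
  then have "W x \<in> borel_measurable unit_lebesgue" by (rule borel_measurable_cong_AE[OF K])
  then show "graphon_degree W x = degree x"
    unfolding graphon_degree_def degree_def using ae K by (intro integral_cong_AE)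
qed

lemma normalized_laplacian_eq:
  assumes [measurable]: "f \<in> borel_measurable unit_lebesgue"
  shows "AE x in unit_lebesgue. normalized_laplacian W f x = normalized_kernel_operator f x - f x"
  using AE_conjI[OF graphon_degree_eq sections_agree]
proof (rule AE_mp, intro AE_I2 impI)
  fix x assume [measurable]: "x \<in> space unit_lebesgue"
    and x: "graphon_degree W x = degree x \<and> (AE y in unit_lebesgue. W x y = K x y)"
  let ?R = "\<lambda>y. complex_of_real (K x y / sqrt (degree x * degree y)) * f y"
  let ?L = "\<lambda>y. complex_of_real (W x y / sqrt (graphon_degree W x * graphon_degree W y)) * f y"
  have R: "?R \<in> borel_measurable unit_lebesgue" by measurable
  have eq: "AE y in unit_lebesgue. ?R y = ?L y"
    using conjunct2[OF x] graphon_degree_eq by eventually_elim (use x in simp)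
  have "integral\<^sup>L unit_lebesgue ?R = integral\<^sup>L unit_lebesgue ?L"
    by (rule integral_cong_AE[OF R borel_measurable_cong_AE[OF R eq] eq])
  then show "normalized_laplacian W f x = normalized_kernel_operator f x - f x"
    by (simp only: normalized_laplacian_def normalized_kernel_operator_def)
qed

lemma normalized_laplacian_in_L2:
  assumes "f \<in> L2" "0 < c" "AE x in unit_lebesgue. c \<le> degree x"
  shows "normalized_laplacian W f \<in> L2"
proof -
  have f [measurable]: "f \<in> borel_measurable unit_lebesgue" and f2: "integrable unit_lebesgue (\<lambda>x. (norm (f x))\<^sup>2)"
    using assms(1) by (auto simp: L2_def)
  let ?N = "\<lambda>x. normalized_kernel_operator f x - f x"
  have N: "?N \<in> borel_measurable unit_lebesgue" by measurable
  have eq: "AE x in unit_lebesgue. ?N x = normalized_laplacian W f x"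
    using normalized_laplacian_eq[OF f] by eventually_elim simp
  have L [measurable]: "normalized_laplacian W f \<in> borel_measurable unit_lebesgue"
    by (rule borel_measurable_cong_AE[OF N eq])
  have "integrable unit_lebesgue (\<lambda>x. 2 * (norm (normalized_kernel_operator f x))\<^sup>2 + 2 * (norm (f x))\<^sup>2)"
    using normalized_kernel_operator_square_integrable[OF f f2 assms(2,3)] f2 by simp
  then have "integrable unit_lebesgue (\<lambda>x. (norm (normalized_laplacian W f x))\<^sup>2)"
  proof (rule Bochner_Integration.integrable_bound)
    have bound: "(norm (a - b))\<^sup>2 \<le> 2 * (norm a)\<^sup>2 + 2 * (norm b)\<^sup>2" for a b :: complex
    proof -
      have "(norm (a - b))\<^sup>2 \<le> (norm a + norm b)\<^sup>2"
        by (intro power_mono norm_triangle_ineq4) simp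
      also have "\<dots> \<le> 2 * (norm a)\<^sup>2 + 2 * (norm b)\<^sup>2"
        using sum_squares_bound[of "norm a" "norm b"] by (simp add: power2_sum)
      finally show ?thesis .
    qed
    show "AE x in unit_lebesgue. norm ((norm (normalized_laplacian W f x))\<^sup>2)
        \<le> norm (2 * (norm (normalized_kernel_operator f x))\<^sup>2 + 2 * (norm (f x))\<^sup>2)"
      using eq
    proof eventually_elim
      case (elim x)
      show ?case using bound[of "normalized_kernel_operator f x" "f x"] unfolding elim[symmetric] by simp
    qed
  qed measurable
  then show ?thesis using L by (simp add: L2_def)
qed

text \<open>Across a sublevel set \<open>S\<close> of \<open>h\<close> and its complement the values of \<open>h\<close> differ, so the kernel vanishes
  almost everywhere on \<open>S \<times> ([0,1] - S)\<close>, and connectedness leaves only measure zero or one for \<open>S\<close>.\<close>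

lemma constant_if_locally_constant:
  fixes h :: "real \<Rightarrow> real"
  assumes conn: "connected_graphon W" and h: "h \<in> borel_measurable unit_lebesgue"
    and loc: "AE (x, y) in unit_lebesgue \<Otimes>\<^sub>M unit_lebesgue. K x y = 0 \<or> h x = h y"
  shows "\<exists>t. AE x in unit_lebesgue. h x = t"
proof (rule AE_constant_if_dichotomy)
  have "emeasure unit_lebesgue {0..1} = 1" by (simp add: emeasure_restrict_space)
  then show "ae_filter unit_lebesgue \<noteq> bot" by (simp add: ae_filter_eq_bot_iff)
  fix q :: real
  define S where "S = {x \<in> space unit_lebesgue. h x \<le> q}"
  have "S \<in> sets unit_lebesgue" unfolding S_def using h by measurable
  then have S: "S \<in> sets lebesgue" "S \<subseteq> {0..1}" by (auto simp: sets_restrict_space_iff)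
  have "AE p in lebesgue_square. (\<lambda>(x, y). indicator (S \<times> ({0..1} - S)) (x, y) * W x y) p = 0"
    unfolding AE_lebesgue_square_iff
    using representative loc by eventually_elim (auto simp: S_def indicator_def)
  moreover have sq: "{0..1} \<times> {0..1} \<in> sets (lebesgue :: (real \<times> real) measure)"
    by (rule sets_lebesgue_Times) auto
  ultimately have "AE p in lebesgue. p \<in> {0..1} \<times> {0..1} \<longrightarrow> (\<lambda>(x, y). indicator (S \<times> ({0..1} - S)) (x, y) * W x y) p = 0"
    by (subst (asm) AE_restrict_space_iff) auto
  then have "AE p in lebesgue. indicator (S \<times> ({0..1} - S)) p *\<^sub>R (case p of (x, y) \<Rightarrow> W x y) = 0"
    by (rule eventually_mono) (use S in \<open>auto simp: indicator_def split: if_splits\<close>)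
  then have "set_lebesgue_integral lebesgue (S \<times> ({0..1} - S)) (\<lambda>(x, y). W x y) = 0"
    unfolding set_lebesgue_integral_def by (rule integral_eq_zero_AE)
  then have "\<not> (0 < measure lebesgue S \<and> measure lebesgue S < 1)"
    using conn S unfolding connected_graphon_def by force
  moreover have "measure lebesgue S \<le> measure lebesgue {0..1::real}"
    by (rule measure_mono_fmeasurable[OF S(2,1)]) simp
  then have "measure lebesgue S \<le> 1" by simp
  moreover have mS: "measure unit_lebesgue S = measure lebesgue S"
    using S by (intro measure_restrict_space) auto
  ultimately consider "measure unit_lebesgue S = 0" | "measure unit_lebesgue S = 1"
    using measure_nonneg[of lebesgue S] by linarith
  then show "(AE x in unit_lebesgue. h x \<le> q) \<or> (AE x in unit_lebesgue. q < h x)"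
  proof cases
    case 1
    then have "S \<in> null_sets unit_lebesgue"
      using \<open>S \<in> sets unit_lebesgue\<close> by (simp add: null_sets_def emeasure_eq_measure)
    then have "AE x in unit_lebesgue. x \<notin> S" by (rule AE_not_in)
    then have "AE x in unit_lebesgue. q < h x"
      using AE_space by eventually_elim (auto simp: S_def)
    then show ?thesis ..
  next
    case 2
    have "measure unit_lebesgue (space unit_lebesgue) = 1"
      by (simp add: measure_restrict_space)
    then have "measure unit_lebesgue (space unit_lebesgue - S) = 0"
      using 2 finite_measure_compl[OF \<open>S \<in> sets unit_lebesgue\<close>] by simp
    then have "space unit_lebesgue - S \<in> null_sets unit_lebesgue"
      using sets.compl_sets[OF \<open>S \<in> sets unit_lebesgue\<close>] by (simp add: null_sets_def emeasure_eq_measure)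
    then have "AE x in unit_lebesgue. x \<notin> space unit_lebesgue - S" by (rule AE_not_in)
    then have "AE x in unit_lebesgue. h x \<le> q"
      using AE_space by eventually_elim (auto simp: S_def)
    then show ?thesis ..
  qed
qed

end

text \<open>A Lebesgue measurable function has a Borel version.  Averaging it with its transpose and truncating to
  \<open>[0,1]\<close> yields symmetry and the bounds at every point, and changes it only on a null set because the
  graphon already has these properties.\<close>

lemma graphon_has_representative:
  assumes "graphon W"
  obtains K where "graphon_representative K W"
proof -
  let ?U = "unit_lebesgue \<Otimes>\<^sub>M unit_lebesgue"
  have sq: "{0..1} \<times> {0..1} \<in> sets (lebesgue :: (real \<times> real) measure)"
    by (rule sets_lebesgue_Times) auto
  have W: "(\<lambda>(x, y). W x y) \<in> borel_measurable lebesgue_square"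
    "\<And>x y. x \<in> {0..1} \<Longrightarrow> y \<in> {0..1} \<Longrightarrow> W x y = W y x \<and> 0 \<le> W x y \<and> W x y \<le> 1"
    using assms by (auto simp: graphon_def)
  have "(\<lambda>p. if p \<in> {0..1} \<times> {0..1} then (\<lambda>(x, y). W x y) p else 0) \<in> borel_measurable lebesgue"
    using W(1) by (subst borel_measurable_if) (use sq in auto)
  from completion_ex_borel_measurable_real[OF this]
  obtain g where g: "g \<in> borel_measurable lborel"
    and ae: "AE p in lborel. (if p \<in> {0..1} \<times> {0..1} then (\<lambda>(x, y). W x y) p else 0) = g p"
    by blast
  have "AE p in lebesgue_square. (\<lambda>(x, y). W x y) p = g p"
    using ae sq by (subst AE_restrict_space_iff) (auto simp: AE_completion_iff elim: eventually_mono)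
  then have agree: "AE p in ?U. (\<lambda>(x, y). W x y) p = g p"
    unfolding AE_lebesgue_square_iff .
  interpret finite_measure unit_lebesgue by (rule finite_measure_unit_lebesgue)
  interpret P: pair_sigma_finite unit_lebesgue unit_lebesgue ..
  have "AE p in distr ?U ?U (\<lambda>(x, y). (y, x)). (\<lambda>(x, y). W x y) p = g p"
    using agree by (subst P.distr_pair_swap[symmetric])
  from AE_distrD[OF _ this]
  have agree_swap: "AE p in ?U. (\<lambda>(x, y). W y x = g (y, x)) p"
    by (simp add: case_prod_unfold)
  have [measurable]: "g \<in> borel_measurable ?U"
    using g by (intro borel_measurable_unit_lebesgue_prod) simp
  define K where "K x y = max 0 (min 1 ((g (x, y) + g (y, x)) / 2))" for x y
  have "graphon_representative K W"
  proof
    show "(\<lambda>(x, y). K x y) \<in> borel_measurable ?U"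
      unfolding K_def by measurable
    show "AE (x, y) in ?U. W x y = K x y"
      using agree agree_swap AE_space
    proof eventually_elim
      case (elim p)
      then show ?case
        using W(2)[of "fst p" "snd p"] by (auto simp: K_def space_pair_measure split: prod.splits)
    qed
  qed (auto simp: K_def add.commute)
  then show thesis by (rule that)
qed

section \<open>The spectrum of the normalized Laplacian\<close>

theorem proposition6p2:
  fixes W :: "real \<Rightarrow> real \<Rightarrow> real" and c :: real
  assumes "graphon W"
    and "0 < c"
    and "\<forall>x\<in>{0..1}. c \<le> graphon_degree W x"
  shows "normalized_laplacian W \<in> L2 \<rightarrow> L2 \<and>
    (\<forall>\<nu>. eigenvalue (normalized_laplacian W) \<nu> \<longrightarrow> \<nu> \<in> \<real> \<and> Re \<nu> \<le> 0) \<and>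
    eigenvalue (normalized_laplacian W) 0 \<and>
    (connected_graphon W \<longrightarrow> has_multiplicity (normalized_laplacian W) 0 1)"
proof -
  obtain K where "graphon_representative K W"
    using graphon_has_representative[OF assms(1)] .
  then interpret graphon_representative K W .
  have deg: "AE x in unit_lebesgue. c \<le> degree x"
    using graphon_degree_eq AE_space
  proof eventually_elim
    case (elim x)
    then have "x \<in> {0..1}" by simp
    with assms(3) have "c \<le> graphon_degree W x" by (rule bspec)
    then show ?case using elim(1) by simp
  qed
  have eigenspace_iff: "f \<in> eigenspace (normalized_laplacian W) \<nu> \<longleftrightarrow>
      f \<in> borel_measurable unit_lebesgue \<and> integrable unit_lebesgue (\<lambda>x. (norm (f x))\<^sup>2) \<and>
      (AE x in unit_lebesgue. normalized_kernel_operator f x - f x = \<nu> * f x)" for f \<nu>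
  proof (cases "f \<in> borel_measurable unit_lebesgue")
    case True
    note eq = normalized_laplacian_eq[OF this]
    have "(AE x in unit_lebesgue. normalized_laplacian W f x = \<nu> * f x) \<longleftrightarrow>
        (AE x in unit_lebesgue. normalized_kernel_operator f x - f x = \<nu> * f x)"
    proof
      assume "AE x in unit_lebesgue. normalized_laplacian W f x = \<nu> * f x"
      with eq show "AE x in unit_lebesgue. normalized_kernel_operator f x - f x = \<nu> * f x"
        by eventually_elim simp
    next
      assume "AE x in unit_lebesgue. normalized_kernel_operator f x - f x = \<nu> * f x"
      with eq show "AE x in unit_lebesgue. normalized_laplacian W f x = \<nu> * f x"
        by eventually_elim simp
    qed
    then show ?thesis by (auto simp: eigenspace_def L2_def)
  qed (simp add: eigenspace_def L2_def)

  define \<psi> where "\<psi> = (\<lambda>x. complex_of_real (sqrt (degree x)))"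
  have \<psi>_eig: "\<psi> \<in> eigenspace (normalized_laplacian W) 0"
    unfolding eigenspace_iff
  proof (intro conjI)
    show "\<psi> \<in> borel_measurable unit_lebesgue" unfolding \<psi>_def by measurable
    have "integrable unit_lebesgue degree"
    proof (rule integrable_const_bound)
      show "AE x in unit_lebesgue. norm (degree x) \<le> measure unit_lebesgue (space unit_lebesgue)"
        by (rule AE_I2) (simp only: real_norm_def abs_of_nonneg degree_nonneg degree_le)
    qed measurable
    then show "integrable unit_lebesgue (\<lambda>x. (norm (\<psi> x))\<^sup>2)"
      by (simp add: \<psi>_def degree_nonneg)
    show "AE x in unit_lebesgue. normalized_kernel_operator \<psi> x - \<psi> x = 0 * \<psi> x"
      using sqrt_degree_null_eigenfunction[OF assms(2) deg] by eventually_elim (simp add: \<psi>_def)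
  qed
  have nontrivial: "ae_filter unit_lebesgue \<noteq> bot"
    by (simp add: ae_filter_eq_bot_iff emeasure_restrict_space)
  have \<psi>_nz: "AE x in unit_lebesgue. \<psi> x \<noteq> 0"
    using deg by eventually_elim (use assms(2) in \<open>auto simp: \<psi>_def\<close>)

  show ?thesis
  proof (intro conjI allI impI)
    show "normalized_laplacian W \<in> L2 \<rightarrow> L2"
      using normalized_laplacian_in_L2[OF _ assms(2) deg] by auto
  next
    fix \<nu> assume "eigenvalue (normalized_laplacian W) \<nu>"
    then obtain f where "f \<in> eigenspace (normalized_laplacian W) \<nu>" and nz: "\<not> (AE x in unit_lebesgue. f x = 0)"
      unfolding eigenvalue_def by blast
    then have "f \<in> borel_measurable unit_lebesgue" "integrable unit_lebesgue (\<lambda>x. (norm (f x))\<^sup>2)"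
      "AE x in unit_lebesgue. normalized_kernel_operator f x - f x = \<nu> * f x"
      by (simp_all add: eigenspace_iff)
    from eigenvalue_nonpos[OF this(1,2) assms(2) deg this(3) nz]
    show "\<nu> \<in> \<real>" "Re \<nu> \<le> 0" by auto
  next
    have "\<not> (AE x in unit_lebesgue. \<psi> x = 0)"
    proof
      assume "AE x in unit_lebesgue. \<psi> x = 0"
      with \<psi>_nz have "AE x in unit_lebesgue. False" by eventually_elim simp
      then show False using nontrivial by (simp add: eventually_False)
    qed
    then show "eigenvalue (normalized_laplacian W) 0"
      unfolding eigenvalue_def using \<psi>_eig by blast
  next
    assume conn: "connected_graphon W"
    show "has_multiplicity (normalized_laplacian W) 0 1"
      unfolding has_multiplicity_def
    proof (intro exI[of _ "\<lambda>_. \<psi>"] conjI allI impI ballI)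
      show "\<psi> \<in> eigenspace (normalized_laplacian W) 0" by (rule \<psi>_eig)
    next
      fix a :: "nat \<Rightarrow> complex" and i :: nat
      assume ae: "AE x in unit_lebesgue. (\<Sum>i<1. a i * \<psi> x) = 0" and "i < 1"
      \<comment> \<open>On a measure space that is not null, a statement independent of the point holds if it holds almost
          everywhere.\<close>
      have "AE x in unit_lebesgue. a 0 = 0"
        using ae \<psi>_nz by eventually_elim auto
      then show "a i = 0"
        using nontrivial \<open>i < 1\<close> by auto
    next
      fix f assume f: "f \<in> eigenspace (normalized_laplacian W) 0"
      define g where "g = (\<lambda>x. f x / sqrt (degree x))"
      have f_meas [measurable]: "f \<in> borel_measurable unit_lebesgue"
        and f2: "integrable unit_lebesgue (\<lambda>x. (norm (f x))\<^sup>2)"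
        and eig: "AE x in unit_lebesgue. normalized_kernel_operator f x - f x = 0"
        using f by (auto simp: eigenspace_iff)
      have [measurable]: "g \<in> borel_measurable unit_lebesgue" unfolding g_def by measurable
      have loc: "AE (x, y) in unit_lebesgue \<Otimes>\<^sub>M unit_lebesgue. K x y = 0 \<or> g x = g y"
        unfolding g_def by (rule null_eigenfunction_locally_constant[OF f_meas f2 assms(2) deg eig])
      have "\<exists>t. AE x in unit_lebesgue. Re (g x) = t"
        by (rule constant_if_locally_constant[OF conn]) (measurable, use loc in eventually_elim, auto)
      moreover have "\<exists>t. AE x in unit_lebesgue. Im (g x) = t"
        by (rule constant_if_locally_constant[OF conn]) (measurable, use loc in eventually_elim, auto)
      ultimately obtain s t where st: "AE x in unit_lebesgue. Re (g x) = s" "AE x in unit_lebesgue. Im (g x) = t"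
        by blast
      have "AE x in unit_lebesgue. f x = (\<Sum>i<1::nat. Complex s t * \<psi> x)"
        using st \<psi>_nz
      proof eventually_elim
        case (elim x)
        then have "g x = Complex s t" by (simp add: complex_eq_iff)
        moreover have "f x = g x * \<psi> x" using elim by (simp add: g_def \<psi>_def)
        ultimately show ?case by simp
      qed
      then show "\<exists>a :: nat \<Rightarrow> complex. AE x in unit_lebesgue. f x = (\<Sum>i<1. a i * \<psi> x)"
        by (intro exI[of _ "\<lambda>_. Complex s t"])
    qed
  qed
qed

end
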